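(* Let $p\ge1$ be an integer. The Power-P subdivision scheme $S_{power_p}$ is uniformly convergent and, for any initial sequence $f\in l^\infty(\mathbb{Z})$, the limit function $S_{power_p}^\infty(f)$ belongs to $C^{1^-}$ if $p\le4$, and to $C^{\alpha^-}$ with $\alpha=-\log_2\left(\tfrac34\right)$ if $p\ge5$.
   Context: $l^\infty(\mathbb{Z})$ is the space of bounded real sequences indexed by $\mathbb{Z}$ with the sup norm. For a sequence $f$, $Df_n=f_{n+1}-2f_n+f_{n-1}$. For an integer $p\ge1$ and $(x,y)\in\mathbb{R}^2$, $$power_p(x,y)=\frac{\mathrm{sign}(x)+\mathrm{sign}(y)}{2}\,\frac{x+y}{2}\left(1-\left|\frac{x-y}{x+y}\right|^p\right),$$ with $power_p(x,y)=0$ when $x+y=0$. The absolute value convention on the mean is the following: the displayed expression is to be read so that $power_p(x,y)$ has the common sign of $x$ and $y$, i.e. $power_p(x,y)=\frac{\mathrm{sign}(x)+\mathrm{sign}(y)}{2}\,\frac{|x+y|}{2}\left(1-\left|\frac{x-y}{x+y}\right|^p\right)$. The Power-P scheme is the interpolatory scheme given by $S_{power_p}(f)_{2n}=f_n$ and $$S_{power_p}(f)_{2n+1}=\frac{f_n+f_{n+1}}{2}-\frac18\,power_p(Df_n,Df_{n+1}).$$ A subdivision scheme $T$ is uniformly convergent if for every $f\in l^\infty(\mathbb{Z})$ there is a continuous function $f^\infty:\mathbb{R}\to\mathbb{R}$ with $\lim_{j\to+\infty}\sup_{n\in\mathbb{Z}}|T^j(f)_n-f^\infty(2^{-j}n)|=0$;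 one writes $f^\infty=T^\infty f$ (the limit function). For $0<\alpha\le1$, $C^{\alpha^-}$ is the set of continuous bounded functions $f:\mathbb{R}\to\mathbb{R}$ such that for every $\alpha'<\alpha$ (with $\alpha'>0$) there is $C>0$ with $|f(x)-f(y)|\le C|x-y|^{\alpha'}$ for all $x,y\in\mathbb{R}$. *)

theory Defs
  imports "HOL-Analysis.Analysis"
begin

definition linf :: "(int \<Rightarrow> real) set" where
  "linf = {f. bounded (range f)}"

definition second_diff :: "(int \<Rightarrow> real) \<Rightarrow> int \<Rightarrow> real" where
  "second_diff f n = f (n + 1) - 2 * f n + f (n - 1)"

definition power_p :: "nat \<Rightarrow> real \<Rightarrow> real \<Rightarrow> real" where
  "power_p p x y =
    (if x + y = 0 then 0
     else (sgn x + sgn y) / 2 * (\<bar>x + y\<bar> / 2) * (1 - \<bar>(x - y) / (x + y)\<bar> ^ p))"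

(* The two refinement rules, merged into one equation with n = m div 2; since div on int rounds
   down, this n is right for negative odd m too.  See power_scheme_even and power_scheme_odd. *)
definition power_scheme :: "nat \<Rightarrow> (int \<Rightarrow> real) \<Rightarrow> int \<Rightarrow> real" where
  "power_scheme p f m =
    (let n = m div 2 in
     if even m then f n
     else (f n + f (n + 1)) / 2 - 1 / 8 * power_p p (second_diff f n) (second_diff f (n + 1)))"

lemma power_scheme_even: "power_scheme p f (2 * n) = f n"
  by (simp add: power_scheme_def)

lemma power_scheme_odd:
  "power_scheme p f (2 * n + 1) =
    (f n + f (n + 1)) / 2 - 1 / 8 * power_p p (second_diff f n) (second_diff f (n + 1))"
  by (simp add: power_scheme_def)

(* The supremum is taken in ereal: on real, SUP of an unbounded family is an unspecified value. *)
definition is_limit_function ::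
  "((int \<Rightarrow> real) \<Rightarrow> int \<Rightarrow> real) \<Rightarrow> (int \<Rightarrow> real) \<Rightarrow> (real \<Rightarrow> real) \<Rightarrow> bool" where
  "is_limit_function T f g \<longleftrightarrow>
    continuous_on UNIV g \<and>
    (\<lambda>j. SUP n. ereal \<bar>(T ^^ j) f n - g (real_of_int n / 2 ^ j)\<bar>) \<longlonglongrightarrow> 0"

definition uniformly_convergent_scheme :: "((int \<Rightarrow> real) \<Rightarrow> int \<Rightarrow> real) \<Rightarrow> bool" where
  "uniformly_convergent_scheme T \<longleftrightarrow> (\<forall>f\<in>linf. \<exists>g. is_limit_function T f g)"

lemma is_limit_function_unique:
  assumes "is_limit_function T f g" "is_limit_function T f h"
  shows "g = h"
proof
  fix x :: real
  define q where "q j = real_of_int \<lfloor>2 ^ j * x\<rfloor> / 2 ^ j" for j :: nat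
  have q_le: "\<bar>q j - x\<bar> \<le> (1/2) ^ j" for j
  proof -
    have "\<bar>real_of_int \<lfloor>2 ^ j * x\<rfloor> - 2 ^ j * x\<bar> \<le> 1"
      by linarith
    moreover have "q j - x = (real_of_int \<lfloor>2 ^ j * x\<rfloor> - 2 ^ j * x) / 2 ^ j"
      by (simp add: q_def field_simps)
    ultimately show ?thesis
      by (simp add: power_divide divide_right_mono)
  qed
  have "(\<lambda>j. q j - x) \<longlonglongrightarrow> 0"
    by (rule Lim_null_comparison[of _ "\<lambda>j. (1/2) ^ j"])
       (use q_le in \<open>auto intro: LIMSEQ_power_zero\<close>)
  then have q: "q \<longlonglongrightarrow> x"
    by (simp add: LIM_zero_iff)
  have lim: "(\<lambda>j. (T ^^ j) f \<lfloor>2 ^ j * x\<rfloor>) \<longlonglongrightarrow> k x" if k: "is_limit_function T f k" for k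
  proof -
    let ?e = "\<lambda>j. \<bar>(T ^^ j) f \<lfloor>2 ^ j * x\<rfloor> - k (q j)\<bar>"
    have "(\<lambda>j. SUP n. ereal \<bar>(T ^^ j) f n - k (real_of_int n / 2 ^ j)\<bar>) \<longlonglongrightarrow> 0"
      using k by (simp add: is_limit_function_def)
    then have "(\<lambda>j. ereal (?e j)) \<longlonglongrightarrow> 0"
      by (rule tendsto_sandwich[OF _ _ tendsto_const, rotated 2])
         (auto simp: q_def intro!: SUP_upper2[OF UNIV_I] always_eventually)
    then have "(\<lambda>j. (T ^^ j) f \<lfloor>2 ^ j * x\<rfloor> - k (q j)) \<longlonglongrightarrow> 0"
      by (simp add: zero_ereal_def tendsto_rabs_zero_iff)
    moreover have "(\<lambda>j. k (q j)) \<longlonglongrightarrow> k x"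
      using k q by (intro isCont_tendsto_compose[of x k])
        (auto simp: is_limit_function_def continuous_on_eq_continuous_at)
    ultimately show ?thesis
      using tendsto_add by fastforce
  qed
  show "g x = h x"
    using lim[OF assms(1)] lim[OF assms(2)] by (rule LIMSEQ_unique)
qed

definition limit_function ::
  "((int \<Rightarrow> real) \<Rightarrow> int \<Rightarrow> real) \<Rightarrow> (int \<Rightarrow> real) \<Rightarrow> real \<Rightarrow> real" where
  "limit_function T f = (THE g. is_limit_function T f g)"

lemma limit_function_eqI: "is_limit_function T f g \<Longrightarrow> limit_function T f = g"
  unfolding limit_function_def by (blast intro: the_equality is_limit_function_unique)

(* The class written C with exponent alpha-minus, for 0 < alpha \<le> 1. *)
definition holder_minus :: "real \<Rightarrow> (real \<Rightarrow> real) set" where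
  "holder_minus \<alpha> =
    {g. continuous_on UNIV g \<and> bounded (range g) \<and>
        (\<forall>\<alpha>'. 0 < \<alpha>' \<and> \<alpha>' < \<alpha> \<longrightarrow>
          (\<exists>C>0. \<forall>x y. \<bar>g x - g y\<bar> \<le> C * \<bar>x - y\<bar> powr \<alpha>'))}"

end

theory Submission
  imports Defs
begin

text \<open>
  Write \<open>D\<close> for second differences and \<open>f\<^sub>j\<close> for the \<open>j\<close>-th iterate of the scheme on \<open>f\<close>. The
  nonlinear mean \<open>P = power_p p\<close> vanishes unless its arguments are nonzero and of the same sign, and
  then it is zero or has that sign; moreover \<open>\<bar>P(x,y)\<bar> \<le> max \<bar>x\<bar> \<bar>y\<bar>\<close>. The second differences of
  the refined sequence are
  \[ D_{2n} = d_n/2 - (P(d_{n-1},d_n) + P(d_n,d_{n+1}))/8, \qquad D_{2n+1} = P(d_n,d_{n+1})/4, \]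
  with \<open>d = Df\<close>. If \<open>\<bar>d\<bar> \<le> M\<close>, the subtracted term in the first formula is zero or has the sign of \<open>d\<^sub>n\<close>
  and size at most \<open>M/4\<close>, so it cannot push \<open>d\<^sub>n/2\<close> outside \<open>[-M/2, M/2]\<close>. Hence the sup norm of
  \<open>Df\<^sub>j\<close> is at least halved in each step (\<open>second_diff_power_scheme_le\<close>), for every \<open>p\<close>.

  With \<open>M\<close> now bounding \<open>Df\<close> for the initial \<open>f\<close>, the sup norms \<open>\<delta>\<^sub>j\<close> of the first differences of
  \<open>f\<^sub>j\<close> satisfy \<open>\<delta>\<^sub>j\<^sub>+\<^sub>1 \<le> \<delta>\<^sub>j/2 + M 2\<^sup>-\<^sup>j/8\<close>, so they decay like \<open>r\<^sup>j\<close> for every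
  \<open>r \<in> (1/2, 1)\<close> (\<open>power_scheme_diff_decay\<close>). For an interpolatory scheme such a decay makes the step
  functions \<open>x \<mapsto> f\<^sub>j(\<lfloor>2\<^sup>j x\<rfloor>)\<close> converge uniformly at rate \<open>r\<^sup>j\<close>, and comparing two points at
  the scale \<open>2\<^sup>-\<^sup>j\<close> of their distance gives the exponent \<open>-log\<^sub>2 r\<close> for the limit
  (\<open>dyadic_limit_hoelder\<close>). Letting \<open>r\<close> tend to \<open>1/2\<close> yields every exponent below \<open>1\<close>. This is the
  class \<open>C\<close> with exponent \<open>1\<^sup>-\<close> for all \<open>p\<close>, which is contained in the one claimed for \<open>p \<ge> 5\<close>.
\<close>

section \<open>Limits of dyadically refined sequences\<close>

lemma dyadic_floor_cases:
  fixes x :: real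
  shows "\<lfloor>2 ^ Suc j * x\<rfloor> = 2 * \<lfloor>2 ^ j * x\<rfloor> \<or> \<lfloor>2 ^ Suc j * x\<rfloor> = 2 * \<lfloor>2 ^ j * x\<rfloor> + 1"
proof -
  have "2 ^ Suc j * x = 2 * (2 ^ j * x)" by simp
  then show ?thesis by linarith
qed

text \<open>The constant \<open>K / (1 - r)\<close> bounds the sum of the increments between successive levels.\<close>

lemma dyadic_limit_exists:
  fixes h :: "nat \<Rightarrow> int \<Rightarrow> real"
  assumes interp: "\<And>j n. h (Suc j) (2 * n) = h j n"
    and decay: "\<And>j n. \<bar>h j (n + 1) - h j n\<bar> \<le> K * r ^ j"
    and r: "0 < r" "r < 1"
  obtains g :: "real \<Rightarrow> real" where "\<And>x. (\<lambda>j. h j \<lfloor>2 ^ j * x\<rfloor>) \<longlonglongrightarrow> g x"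
    and "\<And>j x. \<bar>g x - h j \<lfloor>2 ^ j * x\<rfloor>\<bar> \<le> K / (1 - r) * r ^ j"
proof -
  have K: "0 \<le> K" using decay[of 0 0] by simp
  define s where "s x j = h j \<lfloor>2 ^ j * x\<rfloor>" for x :: real and j
  have step: "\<bar>s x (Suc j) - s x j\<bar> \<le> K * r ^ Suc j" for x j
    using dyadic_floor_cases[of j x] interp[of j "\<lfloor>2 ^ j * x\<rfloor>"]
      decay[of "Suc j" "2 * \<lfloor>2 ^ j * x\<rfloor>"] K r
    by (auto simp: s_def simp del: power_Suc)
  have tail: "\<bar>s x (j + k) - s x j\<bar> \<le> K / (1 - r) * r ^ j" for x j k
  proof -
    have "\<bar>s x (j + k) - s x j\<bar> \<le> K / (1 - r) * (r ^ j - r ^ (j + k))"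
    proof (induction k)
      case (Suc k)
      have "K * r ^ Suc (j + k) \<le> K * r ^ (j + k)"
        using K r by (intro mult_left_mono power_decreasing) auto
      also have "\<dots> = K / (1 - r) * (r ^ (j + k) - r ^ (j + Suc k))"
        using r by (simp add: field_simps)
      finally show ?case
        using Suc step[of x "j + k"] by (simp add: right_diff_distrib)
    qed simp
    also have "\<dots> \<le> K / (1 - r) * r ^ j"
      using K r by (intro mult_left_mono) auto
    finally show ?thesis .
  qed
  have conv: "convergent (s x)" for x
  proof -
    have "summable (\<lambda>j. s x (Suc j) - s x j)"
    proof (rule summable_comparison_test')
      show "summable (\<lambda>j. K * r ^ Suc j)"
        using r by (intro summable_mult summable_ignore_initial_segment[of "\<lambda>j. r ^ j" 1, simplified]
            summable_geometric) auto
      show "norm (s x (Suc j) - s x j) \<le> K * r ^ Suc j" if "0 \<le> j" for j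
        using step by simp
    qed
    then have "convergent (\<lambda>n. s x n - s x 0)"
      by (simp add: summable_iff_convergent sum_lessThan_telescope)
    then show ?thesis
      using convergent_add[of "\<lambda>n. s x n - s x 0" "\<lambda>n. s x 0"] by (simp add: convergent_const)
  qed
  have lim: "s x \<longlonglongrightarrow> lim (s x)" for x
    using conv by (simp add: convergent_LIMSEQ_iff)
  show ?thesis
  proof
    show "(\<lambda>j. h j \<lfloor>2 ^ j * x\<rfloor>) \<longlonglongrightarrow> lim (s x)" for x
      using lim[of x] by (simp add: s_def[abs_def])
    show "\<bar>lim (s x) - h j \<lfloor>2 ^ j * x\<rfloor>\<bar> \<le> K / (1 - r) * r ^ j" for j x
    proof (rule LIMSEQ_le_const2)
      show "(\<lambda>k. \<bar>s x (k + j) - s x j\<bar>) \<longlonglongrightarrow> \<bar>lim (s x) - h j \<lfloor>2 ^ j * x\<rfloor>\<bar>"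
        unfolding s_def[of x j, symmetric]
        by (intro tendsto_intros LIMSEQ_ignore_initial_segment lim)
      show "\<exists>N. \<forall>k\<ge>N. \<bar>s x (k + j) - s x j\<bar> \<le> K / (1 - r) * r ^ j"
        using tail[of x j] by (auto simp: add.commute)
    qed
  qed
qed

lemma dyadic_scale_exists:
  fixes t :: real
  assumes "0 < t" "t \<le> 1"
  obtains j :: nat where "(1/2) ^ Suc j < t" "t \<le> (1/2) ^ j"
proof -
  define j where "j = (LEAST j. (1/2) ^ j < t)"
  have "\<exists>j. (1/2) ^ j < t"
    using real_arch_pow_inv[of t "1/2"] assms by auto
  then have j: "(1/2) ^ j < t" "\<And>i. i < j \<Longrightarrow> \<not> (1/2) ^ i < t"
    unfolding j_def by (rule LeastI_ex) (rule not_less_Least)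
  then obtain i where "j = Suc i"
    using assms by (cases j) auto
  then show ?thesis
    using that[of i] j by force
qed

lemma dyadic_limit_bounded:
  fixes h :: "nat \<Rightarrow> int \<Rightarrow> real" and g :: "real \<Rightarrow> real"
  assumes approx: "\<And>j x. \<bar>g x - h j \<lfloor>2 ^ j * x\<rfloor>\<bar> \<le> E * r ^ j"
    and "h 0 \<in> linf"
  obtains B where "\<And>x. \<bar>g x\<bar> \<le> B"
proof -
  obtain A where A: "\<And>n. \<bar>h 0 n\<bar> \<le> A"
    using assms(2) by (auto simp: linf_def bounded_iff)
  have "\<bar>g x\<bar> \<le> A + E" for x
    using A[of "\<lfloor>x\<rfloor>"] approx[of x 0] by simp
  then show ?thesis by (rule that)
qed

lemma dyadic_limit_hoelder:
  fixes h :: "nat \<Rightarrow> int \<Rightarrow> real" and g :: "real \<Rightarrow> real"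
  assumes approx: "\<And>j x. \<bar>g x - h j \<lfloor>2 ^ j * x\<rfloor>\<bar> \<le> E * r ^ j"
    and decay: "\<And>j n. \<bar>h j (n + 1) - h j n\<bar> \<le> K * r ^ j"
    and bound: "\<And>x. \<bar>g x\<bar> \<le> B"
    and \<beta>: "0 < \<beta>" and r: "r = 2 powr - \<beta>"
  shows "\<exists>C>0. \<forall>x y. \<bar>g x - g y\<bar> \<le> C * \<bar>x - y\<bar> powr \<beta>"
proof -
  have r0: "0 < r" by (simp add: r)
  have E: "0 \<le> E" and K: "0 \<le> K" and B: "0 \<le> B"
    using approx[of 0 0] decay[of 0 0] bound[of 0] by auto
  have r_half: "r = (1/2) powr \<beta>"
    by (simp add: r powr_minus_divide powr_divide)
  have powr_power_swap: "(c powr \<beta>) ^ n = (c ^ n) powr \<beta>" if "0 < c" for c :: real and n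
    using that by (induction n) (simp_all add: powr_mult)
  define C where "C = (2 * E + K) / r + 2 * B + 1"
  have C: "0 < C" using E K B r0 by (auto simp: C_def intro!: add_nonneg_pos)
  have "\<bar>g x - g y\<bar> \<le> C * \<bar>x - y\<bar> powr \<beta>" for x y
  proof -
    consider "x = y" | "1 < \<bar>x - y\<bar>" | "0 < \<bar>x - y\<bar>" "\<bar>x - y\<bar> \<le> 1" by linarith
    then show ?thesis
    proof cases
      case 1
      then show ?thesis by simp
    next
      case 2
      have "\<bar>g x - g y\<bar> \<le> 2 * B" using bound[of x] bound[of y] by linarith
      also have "\<dots> \<le> C" using E K r0 by (simp add: C_def)
      also have "\<dots> \<le> C * \<bar>x - y\<bar> powr \<beta>"
        using 2 \<beta> C by (simp add: ge_one_powr_ge_zero)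
      finally show ?thesis .
    next
      case 3
      then obtain j where j: "(1/2) ^ Suc j < \<bar>x - y\<bar>" "\<bar>x - y\<bar> \<le> (1/2) ^ j"
        by (rule dyadic_scale_exists)
      have "\<bar>2 ^ j * x - 2 ^ j * y\<bar> = 2 ^ j * \<bar>x - y\<bar>"
        by (simp add: abs_mult flip: right_diff_distrib)
      also have "\<dots> \<le> 1"
        using j(2) by (simp add: power_one_over field_simps)
      finally have "\<lfloor>2 ^ j * x\<rfloor> = \<lfloor>2 ^ j * y\<rfloor> \<or> \<lfloor>2 ^ j * x\<rfloor> = \<lfloor>2 ^ j * y\<rfloor> + 1
          \<or> \<lfloor>2 ^ j * y\<rfloor> = \<lfloor>2 ^ j * x\<rfloor> + 1"
        by linarith
      then have "\<bar>h j \<lfloor>2 ^ j * x\<rfloor> - h j \<lfloor>2 ^ j * y\<rfloor>\<bar> \<le> K * r ^ j"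
        using decay[of j "\<lfloor>2 ^ j * x\<rfloor>"] decay[of j "\<lfloor>2 ^ j * y\<rfloor>"] K r0
        by (auto simp: abs_minus_commute)
      then have "\<bar>g x - g y\<bar> \<le> 2 * (E * r ^ j) + K * r ^ j"
        using approx[of x j] approx[of y j] by linarith
      also have "\<dots> = (2 * E + K) / r * r ^ Suc j"
        using r0 by (simp add: field_simps)
      also have "\<dots> \<le> C * r ^ Suc j"
        using B r0 by (intro mult_right_mono) (auto simp: C_def)
      also have "r ^ Suc j = ((1/2) ^ Suc j) powr \<beta>"
        unfolding r_half by (rule powr_power_swap) simp
      also have "\<dots> \<le> \<bar>x - y\<bar> powr \<beta>"
        using j(1) \<beta> by (intro powr_mono2) auto
      finally show ?thesis using C by simp
    qed
  qed
  then show ?thesis using C by blast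
qed

lemma continuous_on_if_hoelder:
  fixes g :: "real \<Rightarrow> real"
  assumes "\<And>x y. \<bar>g x - g y\<bar> \<le> C * \<bar>x - y\<bar> powr \<beta>" "0 < \<beta>"
  shows "continuous_on UNIV g"
proof -
  have "(g \<longlongrightarrow> g x) (at x)" for x
  proof (rule Lim_null[THEN iffD2], rule Lim_null_comparison)
    show "\<forall>\<^sub>F y in at x. norm (g y - g x) \<le> C * \<bar>y - x\<bar> powr \<beta>"
      using assms(1) by (simp add: always_eventually)
    show "((\<lambda>y. C * \<bar>y - x\<bar> powr \<beta>) \<longlongrightarrow> 0) (at x)"
      by (rule tendsto_eq_intros refl tendsto_zero_powrI | use assms(2) in simp)+
  qed
  then show ?thesis by (simp add: continuous_on)
qed

text \<open>The smoothness of the limit of an interpolatory scheme is read off from the rate at which the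
  first differences of the iterates decay.\<close>

lemma interpolatory_scheme_limit:
  assumes interp: "\<And>f n. T f (2 * n) = f n"
    and f: "f \<in> linf"
    and decay: "\<And>r. 1/2 < r \<Longrightarrow> r < 1 \<Longrightarrow> \<exists>K. \<forall>j n. \<bar>(T ^^ j) f (n + 1) - (T ^^ j) f n\<bar> \<le> K * r ^ j"
  shows "\<exists>g \<in> holder_minus 1. is_limit_function T f g"
proof -
  define h where "h j = (T ^^ j) f" for j
  have h: "h (Suc j) (2 * n) = h j n" for j n
    using interp by (simp add: h_def)
  have h0: "h 0 \<in> linf" using f by (simp add: h_def)
  have dec: "\<exists>K. \<forall>j n. \<bar>h j (n + 1) - h j n\<bar> \<le> K * r ^ j" if "1/2 < r" "r < 1" for r
    using decay[OF that] by (simp add: h_def)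
  have lim_ex: "\<exists>(g :: real \<Rightarrow> real) E. (\<forall>x. (\<lambda>j. h j \<lfloor>2 ^ j * x\<rfloor>) \<longlonglongrightarrow> g x) \<and>
      (\<forall>j x. \<bar>g x - h j \<lfloor>2 ^ j * x\<rfloor>\<bar> \<le> E * r ^ j)" if r: "1/2 < r" "r < 1" for r
  proof -
    obtain K where K: "\<And>j n. \<bar>h j (n + 1) - h j n\<bar> \<le> K * r ^ j"
      using dec[OF r] by auto
    have "0 < r" using r by simp
    then show ?thesis by (rule dyadic_limit_exists[OF h K _ r(2)]) blast
  qed
  obtain g :: "real \<Rightarrow> real" where g: "\<And>x. (\<lambda>j. h j \<lfloor>2 ^ j * x\<rfloor>) \<longlonglongrightarrow> g x"
    using lim_ex[of "3/4"] by auto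
  \<comment> \<open>The pointwise limit does not depend on \<open>r\<close>, so the error bound holds for every rate.\<close>
  have approx: "\<exists>E. \<forall>j x. \<bar>g x - h j \<lfloor>2 ^ j * x\<rfloor>\<bar> \<le> E * r ^ j" if r: "1/2 < r" "r < 1" for r
  proof -
    obtain g' :: "real \<Rightarrow> real" and E where g': "\<And>x. (\<lambda>j. h j \<lfloor>2 ^ j * x\<rfloor>) \<longlonglongrightarrow> g' x"
      and E: "\<forall>j x. \<bar>g' x - h j \<lfloor>2 ^ j * x\<rfloor>\<bar> \<le> E * r ^ j"
      using lim_ex[OF r] by auto
    have "g' x = g x" for x
      using g' g by (rule LIMSEQ_unique)
    then show ?thesis using E by auto
  qed
  obtain E where E: "\<And>j x. \<bar>g x - h j \<lfloor>2 ^ j * x\<rfloor>\<bar> \<le> E * (3/4) ^ j"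
    using approx[of "3/4"] by auto
  obtain B where B: "\<And>x. \<bar>g x\<bar> \<le> B"
    using dyadic_limit_bounded[OF E h0] by blast
  have hoelder: "\<exists>C>0. \<forall>x y. \<bar>g x - g y\<bar> \<le> C * \<bar>x - y\<bar> powr \<beta>" if \<beta>: "0 < \<beta>" "\<beta> < 1" for \<beta>
  proof -
    define r :: real where "r = 2 powr - \<beta>"
    have r: "1/2 < r" "r < 1"
      using powr_less_mono[of "-1" "-\<beta>" 2] powr_less_mono[of "-\<beta>" 0 2] \<beta>
      by (simp_all add: r_def powr_minus)
    obtain K where K: "\<And>j n. \<bar>h j (n + 1) - h j n\<bar> \<le> K * r ^ j"
      using dec[OF r] by auto
    obtain E' where E': "\<And>j x. \<bar>g x - h j \<lfloor>2 ^ j * x\<rfloor>\<bar> \<le> E' * r ^ j"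
      using approx[OF r] by auto
    show ?thesis
      by (rule dyadic_limit_hoelder[OF E' K B \<beta>(1) r_def])
  qed
  have cont: "continuous_on UNIV g"
  proof -
    obtain C where "\<And>x y. \<bar>g x - g y\<bar> \<le> C * \<bar>x - y\<bar> powr (1/2)"
      using hoelder[of "1/2"] by auto
    then show ?thesis by (rule continuous_on_if_hoelder) simp
  qed
  have "g \<in> holder_minus 1"
    using cont B hoelder by (auto simp: holder_minus_def bounded_iff)
  moreover have "is_limit_function T f g"
  proof -
    have le: "\<bar>h j n - g (real_of_int n / 2 ^ j)\<bar> \<le> E * (3/4) ^ j" for j n
      using E[of "real_of_int n / 2 ^ j" j] by (simp add: abs_minus_commute)
    have "(\<lambda>j. E * (3/4) ^ j) \<longlonglongrightarrow> E * 0"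
      by (intro tendsto_intros LIMSEQ_power_zero) auto
    then have "(\<lambda>j. ereal (E * (3/4) ^ j)) \<longlonglongrightarrow> 0"
      by (simp add: zero_ereal_def)
    then have "(\<lambda>j. SUP n. ereal \<bar>h j n - g (real_of_int n / 2 ^ j)\<bar>) \<longlonglongrightarrow> 0"
      by (rule tendsto_sandwich[OF _ _ tendsto_const, rotated 2])
        (auto intro!: always_eventually SUP_upper2[OF UNIV_I] SUP_least simp: le)
    then show ?thesis using cont by (simp add: is_limit_function_def h_def)
  qed
  ultimately show ?thesis by blast
qed

section \<open>Decay of differences for the Power-P scheme\<close>

lemma power_p_commute: "power_p p x y = power_p p y x"
  by (simp add: power_p_def add.commute abs_divide abs_minus_commute)

lemma power_p_minus: "power_p p (- x) (- y) = - power_p p x y"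
proof -
  have "- x + - y = - (x + y)" "- x - - y = - (x - y)" "sgn (- x) + sgn (- y) = - (sgn x + sgn y)"
    by (simp_all add: sgn_minus)
  then show ?thesis
    unfolding power_p_def
    by (simp only: abs_minus_cancel neg_equal_0_iff_equal abs_divide
        minus_divide_left [symmetric] mult_minus_left if_distrib [of uminus] minus_zero)
qed

text \<open>No lower bound on \<open>y\<close> is needed: for \<open>y \<le> 0\<close> the mean is zero, because the sign factor vanishes
  when \<open>y < 0 < x\<close>, and \<open>\<bar>(x - y) / (x + y)\<bar> = 1\<close> when exactly one argument is zero.\<close>

lemma power_p_nonneg_first:
  assumes "0 \<le> x" "x \<le> M" "y \<le> M"
  shows "0 \<le> power_p p x y \<and> power_p p x y \<le> M"
proof -
  consider "x = 0" | "y = 0" | "0 < x" "y < 0" | "0 < x" "0 < y" using assms(1) by linarith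
  then show ?thesis
  proof cases
    case 4
    have t: "\<bar>(x - y) / (x + y)\<bar> \<le> 1" using 4 by (simp add: abs_divide)
    have u: "0 \<le> 1 - \<bar>(x - y) / (x + y)\<bar> ^ p" "1 - \<bar>(x - y) / (x + y)\<bar> ^ p \<le> 1"
      using power_le_one[OF abs_ge_zero t, of p] by auto
    have eq: "power_p p x y = (x + y) / 2 * (1 - \<bar>(x - y) / (x + y)\<bar> ^ p)"
      using 4 by (simp add: power_p_def)
    have "power_p p x y \<le> (x + y) / 2 * 1"
      unfolding eq using u 4 by (intro mult_left_mono) auto
    then have "power_p p x y \<le> M" using assms by simp
    moreover have "0 \<le> power_p p x y" unfolding eq using u 4 by simp
    ultimately show ?thesis by simp
  qed (use assms in \<open>auto simp: power_p_def\<close>)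
qed

lemma abs_power_p_le:
  assumes "\<bar>x\<bar> \<le> M" "\<bar>y\<bar> \<le> M"
  shows "\<bar>power_p p x y\<bar> \<le> M"
proof (cases "0 \<le> x")
  case True
  then show ?thesis using power_p_nonneg_first[of x M y p] assms by auto
next
  case False
  then show ?thesis
    using power_p_nonneg_first[of "- x" M "- y" p] assms by (auto simp: power_p_minus)
qed

text \<open>The subtracted terms carry the sign of \<open>y\<close>, so they cannot increase \<open>\<bar>y/2\<bar>\<close> beyond \<open>M/2\<close>.\<close>

lemma half_minus_power_p_le:
  assumes M: "\<bar>x\<bar> \<le> M" "\<bar>y\<bar> \<le> M" "\<bar>z\<bar> \<le> M"
  shows "\<bar>y / 2 - (power_p p x y + power_p p y z) / 8\<bar> \<le> M / 2"
proof (cases "0 \<le> y")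
  case True
  then show ?thesis
    using power_p_nonneg_first[OF True, of M x p] power_p_nonneg_first[OF True, of M z p] M
    unfolding power_p_commute[of p x] add_divide_distrib by linarith
next
  case False
  then show ?thesis
    using power_p_nonneg_first[of "- y" M "- x" p] power_p_nonneg_first[of "- y" M "- z" p] M
    unfolding power_p_commute[of p x] power_p_minus add_divide_distrib by linarith
qed

lemma second_diff_power_scheme_even:
  "second_diff (power_scheme p f) (2 * n) = second_diff f n / 2 -
    (power_p p (second_diff f (n - 1)) (second_diff f n) +
     power_p p (second_diff f n) (second_diff f (n + 1))) / 8"
proof -
  have m: "2 * n - 1 = 2 * (n - 1) + 1" by simp
  show ?thesis
    unfolding second_diff_def[of "power_scheme p f"] m power_scheme_even power_scheme_odd
    by (simp add: second_diff_def[of f n] field_simps)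
qed

lemma second_diff_power_scheme_odd:
  "second_diff (power_scheme p f) (2 * n + 1) =
    power_p p (second_diff f n) (second_diff f (n + 1)) / 4"
proof -
  have "power_scheme p f (2 * n + 1 + 1) = f (n + 1)" "power_scheme p f (2 * n + 1 - 1) = f n"
    using power_scheme_even[of p f "n + 1"] power_scheme_even[of p f n]
    by (simp_all add: algebra_simps)
  then show ?thesis
    unfolding second_diff_def[of "power_scheme p f"] power_scheme_odd by (simp add: field_simps)
qed

lemma second_diff_power_scheme_le:
  assumes M: "\<And>n. \<bar>second_diff f n\<bar> \<le> M"
  shows "\<bar>second_diff (power_scheme p f) m\<bar> \<le> M / 2"
proof (cases "even m")
  case True
  then obtain n where "m = 2 * n" by blast
  then show ?thesis
    using half_minus_power_p_le[OF M M M] by (simp add: second_diff_power_scheme_even)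
next
  case False
  then obtain n where "m = 2 * n + 1" by (blast elim: oddE)
  then show ?thesis
    using abs_power_p_le[OF M M, of p n "n + 1"] M[of 0]
    by (simp add: second_diff_power_scheme_odd abs_divide)
qed

lemma power_scheme_diff_le:
  assumes M: "\<And>n. \<bar>second_diff f n\<bar> \<le> M" and d: "\<And>n. \<bar>f (n + 1) - f n\<bar> \<le> d"
  shows "\<bar>power_scheme p f (m + 1) - power_scheme p f m\<bar> \<le> d / 2 + M / 8"
proof -
  define n where "n = m div 2"
  let ?P = "power_p p (second_diff f n) (second_diff f (n + 1))"
  have P: "\<bar>?P\<bar> \<le> M" by (rule abs_power_p_le[OF M M])
  show ?thesis
  proof (cases "even m")
    case True
    then have "m = 2 * n" by (simp add: n_def)
    then have "power_scheme p f (m + 1) - power_scheme p f m = (f (n + 1) - f n) / 2 - ?P / 8"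
      unfolding \<open>m = 2 * n\<close> power_scheme_even power_scheme_odd by (simp add: field_simps)
    then show ?thesis using P d[of n] unfolding diff_divide_distrib by linarith
  next
    case False
    then have m: "m = 2 * n + 1" by (simp add: n_def)
    then have m1: "m + 1 = 2 * (n + 1)" by simp
    have "power_scheme p f (m + 1) - power_scheme p f m = (f (n + 1) - f n) / 2 + ?P / 8"
      unfolding m1 unfolding m power_scheme_even power_scheme_odd by (simp add: field_simps)
    then show ?thesis using P d[of n] unfolding diff_divide_distrib by linarith
  qed
qed

lemma power_scheme_diff_decay:
  assumes f: "f \<in> linf" and r: "1/2 < r"
  shows "\<exists>K. \<forall>j n. \<bar>(power_scheme p ^^ j) f (n + 1) - (power_scheme p ^^ j) f n\<bar> \<le> K * r ^ j"
proof -
  let ?f = "\<lambda>j. (power_scheme p ^^ j) f"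
  obtain A where A: "\<And>n. \<bar>f n\<bar> \<le> A"
    using f by (auto simp: linf_def bounded_iff)
  have A0: "0 \<le> A" using A[of 0] by linarith
  have second: "\<bar>second_diff (?f j) n\<bar> \<le> 4 * A * (1/2) ^ j" for j n
  proof (induction j arbitrary: n)
    case 0
    show ?case using A[of n] A[of "n + 1"] A[of "n - 1"] by (simp add: second_diff_def abs_le_iff)
  next
    case (Suc j)
    from second_diff_power_scheme_le[OF Suc] show ?case by simp
  qed
  \<comment> \<open>\<open>2 A\<close> covers level zero; the second term absorbs the second differences in
    \<open>K r\<^sup>j / 2 + A 2\<^sup>-\<^sup>j / 2 \<le> K r\<^sup>j\<^sup>+\<^sup>1\<close>.\<close>
  define K where "K = 2 * A + A / (2 * r - 1)"
  have K: "A \<le> K * (2 * r - 1)"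
  proof -
    have "K * (2 * r - 1) = 2 * A * (2 * r - 1) + A"
      using r by (simp add: K_def distrib_right)
    then show ?thesis using A0 r by simp
  qed
  have "\<bar>?f j (n + 1) - ?f j n\<bar> \<le> K * r ^ j" for j n
  proof (induction j arbitrary: n)
    case 0
    have "0 \<le> A / (2 * r - 1)" using A0 r by simp
    then show ?case using A[of n] A[of "n + 1"] by (simp add: K_def abs_le_iff)
  next
    case (Suc j)
    have "\<bar>?f (Suc j) (n + 1) - ?f (Suc j) n\<bar> \<le> K * r ^ j / 2 + 4 * A * (1/2) ^ j / 8"
      using power_scheme_diff_le[OF second Suc] by simp
    also have "\<dots> = K * r ^ j / 2 + A * (1/2) ^ j / 2" by simp
    also have "A * (1/2) ^ j \<le> (K * (2 * r - 1)) * r ^ j"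
      using K A0 r by (intro mult_mono power_mono) auto
    also have "K * r ^ j / 2 + (K * (2 * r - 1)) * r ^ j / 2 = K * r ^ Suc j"
      by (simp add: field_simps)
    finally show ?case by simp
  qed
  then show ?thesis by blast
qed

lemma holder_minus_mono: "\<alpha> \<le> \<beta> \<Longrightarrow> holder_minus \<beta> \<subseteq> holder_minus \<alpha>"
  unfolding holder_minus_def by auto

theorem proposition2:
  fixes p :: nat
  assumes "p \<ge> 1"
  shows "uniformly_convergent_scheme (power_scheme p) \<and>
    (\<forall>f\<in>linf.
      (p \<le> 4 \<longrightarrow> limit_function (power_scheme p) f \<in> holder_minus 1) \<and>
      (p \<ge> 5 \<longrightarrow> limit_function (power_scheme p) f \<in> holder_minus (- log 2 (3 / 4))))"
proof -
  have ex: "\<exists>g \<in> holder_minus 1. is_limit_function (power_scheme p) f g" if "f \<in> linf" for f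
    using power_scheme_even that power_scheme_diff_decay[OF that]
    by (rule interpolatory_scheme_limit)
  then have "uniformly_convergent_scheme (power_scheme p)"
    unfolding uniformly_convergent_scheme_def by blast
  moreover have "limit_function (power_scheme p) f \<in> holder_minus 1" if "f \<in> linf" for f
    using ex[OF that] limit_function_eqI by metis
  moreover have "holder_minus 1 \<subseteq> holder_minus (- log 2 (3 / 4))"
  proof (rule holder_minus_mono)
    have "log 2 (1/2) \<le> log 2 (3/4 :: real)"
      by (subst log_le_cancel_iff) auto
    then show "- log 2 (3 / 4) \<le> (1 :: real)"
      by (simp add: log_divide)
  qed
  ultimately show ?thesis by blast
qed

end
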